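(* For every $(\varepsilon,\delta)\in\mathbb{R}^2$, the following relations hold for transformations of the set of marked boxes: $$\sigma_{(-\varepsilon,-\delta)}=\sigma_{(\varepsilon,\delta)}^{-1}\qquad\text{and}\qquad i\,\sigma_{(\varepsilon,\delta)}=\sigma_{(-\varepsilon,-\delta)}\,i.$$
   Context: Let $V$ be a 3-dimensional real vector space. An overmarked box is $\Theta=((p,q,r,s;t,b),(P,Q,R,S;T,B))$ with $p,\dots,b\in\mathbf{P}(V)$ and lines $P,\dots,B$ of $\mathbf{P}(V)$ such that $P=ts$, $Q=tr$, $R=bq$, $S=bp$, $T=pq$, $B=rs$ (here $xy$ is the line through $x,y$) and $T\cap B\notin\{p,q,r,s,t,b\}$. A $\Theta$-basis is a basis of $V$, unique up to scaling, in which $p=[-1:1:0]$, $q=[1:1:0]$, $r=[1:0:1]$, $s=[-1:0:1]$. A marked box is an orbit of $\Theta$ under the involution $j:\Theta\mapsto((q,p,s,r;t,b),(Q,P,S,R;T,B))$. The involution $i$ maps $\Theta$ to $((s,r,p,q;b,t),(R,S,Q,P;B,T))$; it commutes with $j$ and acts on marked boxes. For $(\varepsilon,\delta)\in\mathbb{R}^2$ let $$\Sigma_{(\varepsilon,\delta)}=\begin{pmatrix}1&0&0\\0&e^{-\delta}\cosh\varepsilon&-\sinh\varepsilon\\0&-\sinh\varepsilon&e^{\delta}\cosh\varepsilon\end{pmatrix}$$ and let $\sigma_{(\varepsilon,\delta)}(\Theta)$ be the image of $\Theta$ under the projective transformation with matrix $\Sigma_{(\varepsilon,\delta)}$ in a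 $\Theta$-basis; it commutes with $j$ and thus acts on marked boxes. *)

theory Defs
  imports "HOL-Analysis.Analysis"
begin

text \<open>The 3-dimensional real vector space V is taken to be real^3.
  A point of P(V) is a 1-dimensional subspace, a line of P(V) a 2-dimensional subspace.\<close>

type_synonym psub = "(real^3) set"
type_synonym box = "(psub \<times> psub \<times> psub \<times> psub \<times> psub \<times> psub) \<times>
                    (psub \<times> psub \<times> psub \<times> psub \<times> psub \<times> psub)"

definition is_ppoint :: "psub \<Rightarrow> bool" where
  "is_ppoint x \<longleftrightarrow> (\<exists>v. v \<noteq> 0 \<and> x = span {v})"

definition is_pline :: "psub \<Rightarrow> bool" where
  "is_pline L \<longleftrightarrow> subspace L \<and> dim L = 2"

text \<open>The line xy through two (distinct) points.\<close>
definition join :: "psub \<Rightarrow> psub \<Rightarrow> psub" where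
  "join x y = span (x \<union> y)"

definition overmarked :: "box \<Rightarrow> bool" where
  "overmarked \<Theta> = (case \<Theta> of ((p,q,r,s,t,b),(P,Q,R,S,T,B)) \<Rightarrow>
      is_ppoint p \<and> is_ppoint q \<and> is_ppoint r \<and> is_ppoint s \<and> is_ppoint t \<and> is_ppoint b \<and>
      is_pline P \<and> is_pline Q \<and> is_pline R \<and> is_pline S \<and> is_pline T \<and> is_pline B \<and>
      P = join t s \<and> Q = join t r \<and> R = join b q \<and> S = join b p \<and>
      T = join p q \<and> B = join r s \<and>
      T \<noteq> B \<and> T \<inter> B \<notin> {p, q, r, s, t, b})"

text \<open>Theta-basis, given as the invertible matrix whose columns are the basis vectors;
  the point with homogeneous coordinates c in this basis is span {E *v c}.\<close>
definition theta_basis :: "box \<Rightarrow> real^3^3 \<Rightarrow> bool" where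
  "theta_basis \<Theta> E = (case \<Theta> of ((p,q,r,s,t,b),_) \<Rightarrow>
      invertible E \<and>
      p = span {E *v vector [-1, 1, 0]} \<and> q = span {E *v vector [1, 1, 0]} \<and>
      r = span {E *v vector [1, 0, 1]} \<and> s = span {E *v vector [-1, 0, 1]})"

definition Sig_mat :: "real \<Rightarrow> real \<Rightarrow> real^3^3" where
  "Sig_mat \<epsilon> \<delta> = vector [vector [1, 0, 0],
                           vector [0, exp (-\<delta>) * cosh \<epsilon>, - sinh \<epsilon>],
                           vector [0, - sinh \<epsilon>, exp \<delta> * cosh \<epsilon>]]"

definition map_box :: "(real^3 \<Rightarrow> real^3) \<Rightarrow> box \<Rightarrow> box" where
  "map_box g \<Theta> = (case \<Theta> of ((p,q,r,s,t,b),(P,Q,R,S,T,B)) \<Rightarrow>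
      ((g ` p, g ` q, g ` r, g ` s, g ` t, g ` b),
       (g ` P, g ` Q, g ` R, g ` S, g ` T, g ` B)))"

definition sigma :: "real \<Rightarrow> real \<Rightarrow> box \<Rightarrow> box" where
  "sigma \<epsilon> \<delta> \<Theta> = (let E = (SOME E. theta_basis \<Theta> E) in
      map_box (\<lambda>v. E *v (Sig_mat \<epsilon> \<delta> *v (matrix_inv E *v v))) \<Theta>)"

definition box_j :: "box \<Rightarrow> box" where
  "box_j \<Theta> = (case \<Theta> of ((p,q,r,s,t,b),(P,Q,R,S,T,B)) \<Rightarrow>
      ((q,p,s,r,t,b),(Q,P,S,R,T,B)))"

definition box_i :: "box \<Rightarrow> box" where
  "box_i \<Theta> = (case \<Theta> of ((p,q,r,s,t,b),(P,Q,R,S,T,B)) \<Rightarrow>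
      ((s,r,p,q,b,t),(R,S,Q,P,B,T)))"

text \<open>Marked boxes: orbits of overmarked boxes under the involution j.\<close>
definition marked_boxes :: "box set set" where
  "marked_boxes = {{\<Theta>, box_j \<Theta>} | \<Theta>. overmarked \<Theta>}"

text \<open>Induced action on marked boxes of a map commuting with j.\<close>
definition on_marked :: "(box \<Rightarrow> box) \<Rightarrow> box set \<Rightarrow> box set" where
  "on_marked f M = f ` M"

end

theory Submission
  imports Defs
begin

text \<open>Overmarkedness says that no three of p, q, r, s are collinear, so they form a projective
  frame: a \<Theta>-basis exists and is unique up to a scalar, and \<sigma>(\<epsilon>,\<delta>) is conjugation by
  \<Sigma>(\<epsilon>,\<delta>) in any \<Theta>-basis. If E is a \<Theta>-basis, then E \<Sigma>(\<epsilon>,\<delta>) is one for \<sigma>(\<epsilon>,\<delta>)(\<Theta>), and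
  E J, E I are ones for j(\<Theta>), i(\<Theta>), where J = diag(-1,1,1) and I is the quarter turn
  (x,y,z) \<mapsto> (x,-z,y). Both relations thereby reduce to the matrix identities
  \<Sigma>(\<epsilon>,\<delta>) \<Sigma>(-\<epsilon>,-\<delta>) = 1, J \<Sigma>(\<epsilon>,\<delta>) J\<inverse> = \<Sigma>(\<epsilon>,\<delta>) and I \<Sigma>(-\<epsilon>,-\<delta>) I\<inverse> = \<Sigma>(\<epsilon>,\<delta>).\<close>

section \<open>Linear algebra\<close>

lemma span_scale_nonzero:
  fixes v :: "'a::real_vector"
  assumes "k \<noteq> 0"
  shows "span {k *\<^sub>R v} = span {v}"
proof -
  have "v = (1 / k) *\<^sub>R (k *\<^sub>R v)"
    using assms by simp
  then have "v \<in> span {k *\<^sub>R v}"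
    by (metis span_base span_scale singletonI)
  moreover have "k *\<^sub>R v \<in> span {v}"
    by (simp add: span_base span_scale)
  ultimately show ?thesis
    by (simp add: span_eq)
qed

lemma span_singleton_image: "(*v) (F :: real^3^3) ` span {w} = span {F *v w}"
  using span_linear_image[OF matrix_vector_mul_linear, of F "{w}"] by simp

lemma cramer_relation_3:
  fixes a b c d :: "real^3"
  shows "det (vector [b, c, d] :: real^3^3) *\<^sub>R a - det (vector [a, c, d] :: real^3^3) *\<^sub>R b
       + det (vector [a, b, d] :: real^3^3) *\<^sub>R c - det (vector [a, b, c] :: real^3^3) *\<^sub>R d = 0"
  by (simp add: det_3 vec_eq_iff forall_3 algebra_simps)

lemma transpose_vector_mult_3:
  "transpose (vector [u, v, w] :: real^3^3) *v x = x$1 *\<^sub>R u + x$2 *\<^sub>R v + x$3 *\<^sub>R w"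
  by (simp add: vec_eq_iff forall_3 matrix_vector_mult_def transpose_def sum_3 mult.commute)

lemma det_rows_eq_0_imp_dependent:
  fixes u v w :: "real^3"
  assumes "det (vector [u, v, w] :: real^3^3) = 0"
  obtains a b c where "a \<noteq> 0 \<or> b \<noteq> 0 \<or> c \<noteq> 0" "a *\<^sub>R u + b *\<^sub>R v + c *\<^sub>R w = 0"
proof -
  let ?A = "transpose (vector [u, v, w] :: real^3^3)"
  note comb = transpose_vector_mult_3[of u v w]
  have "det ?A = 0"
    using assms by simp
  then have "\<not> inj ((*v) ?A)"
    using det_nz_iff_inj[OF matrix_vector_mul_linear[of ?A]] by (metis matrix_of_matrix_vector_mul)
  then obtain x y where "?A *v x = ?A *v y" "x \<noteq> y"
    unfolding inj_def by blast
  then have "?A *v (x - y) = 0" "x - y \<noteq> 0"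
    by (simp_all add: matrix_vector_mult_diff_distrib)
  then show thesis
    using that[of "(x - y)$1" "(x - y)$2" "(x - y)$3"] comb[of "x - y"]
    by (auto simp: vec_eq_iff forall_3)
qed

lemma dim_span_pair_eq_2_imp_independent:
  fixes x y :: "real^3"
  assumes "dim (span {x, y}) = 2"
  shows "x \<noteq> y" "independent {x, y}"
proof -
  have "2 \<le> card {x, y}"
    using dim_le_card[of "{x, y}" "{x, y}"] assms by (simp add: span_base subsetI)
  then show "x \<noteq> y" by (cases "x = y") auto
  then show "independent {x, y}"
    using card_eq_dim[of "{x, y}" "span {x, y}"] assms by (auto simp: span_base)
qed

lemma in_span_pair_if_dependent:
  fixes x y z :: "real^3"
  assumes "dim (span {x, y}) = 2"
    and "a \<noteq> 0 \<or> b \<noteq> 0 \<or> c \<noteq> 0" "a *\<^sub>R x + b *\<^sub>R y + c *\<^sub>R z = 0"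
  shows "z \<in> span {x, y}"
proof (cases "c = 0")
  case True
  have "independent {x, y}" "independent {y, x}" "x \<noteq> y"
    using dim_span_pair_eq_2_imp_independent[OF assms(1)] by (simp_all add: insert_commute)
  then have "x \<notin> span {y}" "y \<notin> span {x}"
    by (simp_all add: independent_insert)
  moreover have "a \<noteq> 0 \<Longrightarrow> x = (- b / a) *\<^sub>R y" "b \<noteq> 0 \<Longrightarrow> y = (- a / b) *\<^sub>R x"
    using assms(3) True by (auto simp: vec_eq_iff field_simps add_eq_0_iff2)
  ultimately show ?thesis
    using assms(2) True by (metis span_base span_scale singletonI)
next
  case False
  have "c *\<^sub>R z = - (a *\<^sub>R x + b *\<^sub>R y)"
    using assms(3) by (metis add.commute eq_neg_iff_add_eq_0)
  then have "z = (- a / c) *\<^sub>R x + (- b / c) *\<^sub>R y"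
    using False by (simp add: vec_eq_iff field_simps)
  then show ?thesis
    by (metis span_add span_base span_scale insertI1 insertI2 singletonI)
qed

lemma matrix_inv_right: "invertible (A :: 'a::field^'n^'n) \<Longrightarrow> A ** matrix_inv A = mat 1"
  and matrix_inv_left: "invertible (A :: 'a::field^'n^'n) \<Longrightarrow> matrix_inv A ** A = mat 1"
  unfolding invertible_def matrix_inv_def by (metis (mono_tags, lifting) someI_ex)+

lemma matrix_inv_unique:
  fixes A B :: "'a::field^'n^'n"
  assumes "A ** B = mat 1"
  shows "matrix_inv A = B"
proof -
  have "invertible A"
    using assms by (auto simp: invertible_right_inverse)
  then have "matrix_inv A = (matrix_inv A ** A) ** B"
    by (simp only: matrix_mul_assoc[symmetric] assms matrix_mul_rid)
  also have "\<dots> = B"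
    using \<open>invertible A\<close> by (simp add: matrix_inv_left)
  finally show ?thesis .
qed

lemma matrix_inv_mult:
  fixes A B :: "'a::field^'n^'n"
  assumes "invertible A" "invertible B"
  shows "matrix_inv (A ** B) = matrix_inv B ** matrix_inv A"
proof (rule matrix_inv_unique)
  have "(A ** B) ** (matrix_inv B ** matrix_inv A) = A ** ((B ** matrix_inv B) ** matrix_inv A)"
    by (simp only: matrix_mul_assoc)
  also have "\<dots> = mat 1"
    using assms by (simp add: matrix_inv_right)
  finally show "(A ** B) ** (matrix_inv B ** matrix_inv A) = mat 1" .
qed

lemma matrix_inv_scaleR:
  fixes A :: "real^'n^'n"
  assumes "k \<noteq> 0" "invertible A"
  shows "matrix_inv (k *\<^sub>R A) = (1 / k) *\<^sub>R matrix_inv A"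
  by (rule matrix_inv_unique) (simp add: assms matrix_scalar_ac matrix_inv_right)

definition matrix_conj :: "'a::field^'n^'n \<Rightarrow> 'a^'n^'n \<Rightarrow> 'a^'n^'n" where
  "matrix_conj E A = E ** A ** matrix_inv E"

lemma matrix_conj_mult:
  "invertible E \<Longrightarrow> matrix_conj E A ** matrix_conj E B = matrix_conj E (A ** B)"
  unfolding matrix_conj_def
  by (simp add: matrix_mul_assoc[symmetric]) (simp add: matrix_mul_assoc matrix_inv_left)

lemma matrix_conj_one: "invertible E \<Longrightarrow> matrix_conj E (mat 1) = mat 1"
  unfolding matrix_conj_def by (simp add: matrix_inv_right)

lemma matrix_conj_conj:
  "invertible E \<Longrightarrow> invertible C \<Longrightarrow> matrix_conj (E ** C) A = matrix_conj E (matrix_conj C A)"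
  unfolding matrix_conj_def by (simp add: matrix_inv_mult matrix_mul_assoc)

lemma matrix_conj_scaleR:
  fixes E :: "real^'n^'n"
  shows "k \<noteq> 0 \<Longrightarrow> invertible E \<Longrightarrow> matrix_conj (k *\<^sub>R E) A = matrix_conj E A"
  unfolding matrix_conj_def by (simp add: matrix_inv_scaleR matrix_scalar_ac flip: scalar_matrix_assoc)

lemma matrix_conj_mult_self: "invertible E \<Longrightarrow> matrix_conj E A ** E = E ** A"
  unfolding matrix_conj_def by (simp add: matrix_mul_assoc[symmetric]) (simp add: matrix_mul_assoc matrix_inv_left)

lemma invertible_matrix_conj:
  assumes "invertible E" "invertible A"
  shows "invertible (matrix_conj E A)"
proof -
  have "invertible (matrix_inv E)"
    using assms(1) matrix_inv_right invertible_left_inverse by blast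
  then show ?thesis
    unfolding matrix_conj_def using assms by (intro invertible_mult)
qed

section \<open>Projective frames\<close>

lemma pline_inter_eq_span:
  fixes T B :: "(real^3) set"
  assumes "is_pline T" "is_pline B" "T \<noteq> B" "z \<in> T \<inter> B" "z \<noteq> 0"
  shows "T \<inter> B = span {z}"
proof -
  have sub: "subspace T" "subspace B" "subspace (T \<inter> B)" and dim: "dim T = 2" "dim B = 2"
    using assms(1,2) by (auto simp: is_pline_def subspace_inter)
  have "dim (T \<inter> B) < 2"
  proof (rule ccontr)
    assume "\<not> dim (T \<inter> B) < 2"
    then have "T \<inter> B = T" "T \<inter> B = B"
      using subspace_dim_equal[OF sub(3)] sub dim dim_subset[of "T \<inter> B"] by (metis inf_le1 inf_le2 le_antisym not_less)+
    then show False using assms(3) by simp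
  qed
  then have "dim (T \<inter> B) \<le> dim (span {z})"
    using assms(5) by simp
  moreover have "span {z} \<subseteq> T \<inter> B"
    using assms(4) sub(3) by (intro span_minimal) auto
  ultimately show ?thesis
    using subspace_dim_equal[OF subspace_span sub(3)] by (metis (no_types) dim_span)
qed

lemma det_rows_ne_0_off_line:
  fixes x y z :: "real^3"
  assumes "is_pline (span {x, y})" "is_pline B" "span {x, y} \<noteq> B"
    and "z \<in> B" "z \<noteq> 0" "span {x, y} \<inter> B \<noteq> span {z}"
  shows "det (vector [x, y, z] :: real^3^3) \<noteq> 0"
proof
  assume "det (vector [x, y, z] :: real^3^3) = 0"
  then have "z \<in> span {x, y}"
    using in_span_pair_if_dependent assms(1) unfolding is_pline_def
    by (metis det_rows_eq_0_imp_dependent)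
  then show False
    using pline_inter_eq_span[OF assms(1-3)] assms(4-6) by blast
qed

lemma det_frame_columns:
  fixes p q r s :: "real^3"
  shows "det (vector [b *\<^sub>R q - a *\<^sub>R p, a *\<^sub>R p + b *\<^sub>R q, c *\<^sub>R r + d *\<^sub>R s] :: real^3^3)
    = - 2 * a * b * (c * det (vector [p, q, r] :: real^3^3) + d * det (vector [p, q, s] :: real^3^3))"
  by (simp add: det_3 algebra_simps)

lemma exists_frame_matrix:
  fixes p q r s :: "real^3"
  assumes "det (vector [p, q, r] :: real^3^3) \<noteq> 0" "det (vector [p, q, s] :: real^3^3) \<noteq> 0"
    and "det (vector [r, s, p] :: real^3^3) \<noteq> 0" "det (vector [r, s, q] :: real^3^3) \<noteq> 0"
  obtains E :: "real^3^3" where "invertible E"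
    "span {E *v vector [-1, 1, 0]} = span {p}" "span {E *v vector [1, 1, 0]} = span {q}"
    "span {E *v vector [1, 0, 1]} = span {r}" "span {E *v vector [-1, 0, 1]} = span {s}"
proof -
  define a where "a = det (vector [q, r, s] :: real^3^3)"
  define b where "b = det (vector [p, r, s] :: real^3^3)"
  define c where "c = det (vector [p, q, s] :: real^3^3)"
  define d where "d = det (vector [p, q, r] :: real^3^3)"
  have nz: "a \<noteq> 0" "b \<noteq> 0" "c \<noteq> 0" "d \<noteq> 0"
    using assms unfolding a_def b_def c_def d_def by (simp_all add: det_3 algebra_simps)
  have "a *\<^sub>R p - b *\<^sub>R q + c *\<^sub>R r - d *\<^sub>R s = 0"
    unfolding a_def b_def c_def d_def by (rule cramer_relation_3)
  then have rel: "b *\<^sub>R q - a *\<^sub>R p = c *\<^sub>R r - d *\<^sub>R s"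
    by (simp add: algebra_simps)
  \<comment> \<open>a, b, c, d are the coefficients of the linear relation among p, q, r, s, so the third and fourth
    frame vectors are also sent to multiples of r and s\<close>
  define E where "E = transpose (vector [b *\<^sub>R q - a *\<^sub>R p, a *\<^sub>R p + b *\<^sub>R q, c *\<^sub>R r + d *\<^sub>R s] :: real^3^3)"
  have "det E = - 4 * a * b * c * d"
    unfolding E_def det_transpose det_frame_columns by (simp add: c_def d_def)
  then have inv: "invertible E"
    using nz by (simp add: invertible_det_nz)
  have images_pq: "E *v vector [-1, 1, 0] = (2 * a) *\<^sub>R p" "E *v vector [1, 1, 0] = (2 * b) *\<^sub>R q"
    unfolding E_def transpose_vector_mult_3 by (simp_all add: scaleR_2 flip: scaleR_scaleR)
  have images_rs: "E *v vector [1, 0, 1] = (2 * c) *\<^sub>R r" "E *v vector [-1, 0, 1] = (2 * d) *\<^sub>R s"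
    unfolding E_def transpose_vector_mult_3 rel by (simp_all add: scaleR_2 flip: scaleR_scaleR)
  show thesis
    by (rule that[OF inv, unfolded images_pq images_rs]) (simp_all add: nz span_scale_nonzero)
qed

lemma join_span_singletons: "join (span {u}) (span {v}) = span {u, v}"
  unfolding join_def
proof (subst span_eq, intro conjI)
  show "span {u} \<union> span {v} \<subseteq> span {u, v}"
    by (auto intro: span_mono[THEN subsetD])
  show "{u, v} \<subseteq> span (span {u} \<union> span {v})"
    by (auto intro!: span_base simp: span_base)
qed

section \<open>\<Theta>-bases of boxes\<close>

lemma box_cases:
  obtains p q r s t b P Q R S T B where "\<Theta> = ((p, q, r, s, t, b), (P, Q, R, S, T, B))"
  by (metis prod.collapse)

lemma overmarked_has_theta_basis:
  assumes "overmarked \<Theta>"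
  obtains E where "theta_basis \<Theta> E"
proof -
  obtain p q r s t b P Q R S T B where \<Theta>: "\<Theta> = ((p, q, r, s, t, b), (P, Q, R, S, T, B))"
    by (rule box_cases)
  from assms have "is_ppoint p" "is_ppoint q" "is_ppoint r" "is_ppoint s"
    and lines: "is_pline T" "is_pline B" "T \<noteq> B" "T = join p q" "B = join r s"
    and meet: "T \<inter> B \<noteq> p" "T \<inter> B \<noteq> q" "T \<inter> B \<noteq> r" "T \<inter> B \<noteq> s"
    unfolding \<Theta> overmarked_def by auto
  then obtain vp vq vr vs where nz: "vp \<noteq> 0" "vq \<noteq> 0" "vr \<noteq> 0" "vs \<noteq> 0"
    and reps: "p = span {vp}" "q = span {vq}" "r = span {vr}" "s = span {vs}"
    unfolding is_ppoint_def by metis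
  have TB: "T = span {vp, vq}" "B = span {vr, vs}"
    using lines(4,5) by (simp_all add: reps join_span_singletons)
  note lines = lines(1-3)[unfolded TB] and meet = meet[unfolded TB reps]
  have "vp \<in> span {vp, vq}" "vq \<in> span {vp, vq}" "vr \<in> span {vr, vs}" "vs \<in> span {vr, vs}"
    by (simp_all add: span_base)
  then have "det (vector [vp, vq, vr] :: real^3^3) \<noteq> 0" "det (vector [vp, vq, vs] :: real^3^3) \<noteq> 0"
    and "det (vector [vr, vs, vp] :: real^3^3) \<noteq> 0" "det (vector [vr, vs, vq] :: real^3^3) \<noteq> 0"
    using det_rows_ne_0_off_line[OF lines] det_rows_ne_0_off_line[OF lines(2,1) lines(3)[symmetric]]
      nz meet by (simp_all add: Int_commute)
  then obtain E :: "real^3^3" where "invertible E"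
    "span {E *v vector [-1, 1, 0]} = p" "span {E *v vector [1, 1, 0]} = q"
    "span {E *v vector [1, 0, 1]} = r" "span {E *v vector [-1, 0, 1]} = s"
    unfolding reps by (rule exists_frame_matrix)
  then have "theta_basis \<Theta> E"
    unfolding \<Theta> theta_basis_def by simp
  then show thesis
    by (rule that)
qed

lemma theta_basis_invertible: "theta_basis \<Theta> E \<Longrightarrow> invertible E"
  by (cases \<Theta> rule: box_cases) (simp add: theta_basis_def)

lemma theta_basis_unique:
  assumes E: "theta_basis \<Theta> E" and E': "theta_basis \<Theta> E'"
  obtains k where "k \<noteq> 0" "E' = k *\<^sub>R E"
proof -
  define up where "up = (vector [-1, 1, 0] :: real^3)"
  define uq where "uq = (vector [1, 1, 0] :: real^3)"
  define ur where "ur = (vector [1, 0, 1] :: real^3)"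
  define us where "us = (vector [-1, 0, 1] :: real^3)"
  have "span {E' *v u} = span {E *v u}" if "u \<in> {up, uq, ur, us}" for u
    using E E' that unfolding up_def uq_def ur_def us_def
    by (cases \<Theta> rule: box_cases) (auto simp: theta_basis_def)
  then have "\<exists>k. E' *v u = k *\<^sub>R (E *v u)" if "u \<in> {up, uq, ur, us}" for u
    using that span_base[of "E' *v u" "{E' *v u}"] by (fastforce simp: span_singleton)
  then obtain kp kq kr ks where k: "E' *v up = kp *\<^sub>R (E *v up)" "E' *v uq = kq *\<^sub>R (E *v uq)"
      "E' *v ur = kr *\<^sub>R (E *v ur)" "E' *v us = ks *\<^sub>R (E *v us)"
    by (metis insertCI)
  \<comment> \<open>the relation uq - up = ur - us among the frame vectors forces the scalars to agree\<close>
  have "uq - up = ur - us"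
    unfolding up_def uq_def ur_def us_def by (simp add: vec_eq_iff forall_3)
  then have "E' *v (uq - up) = E' *v (ur - us)"
    by simp
  then have "E *v (kq *\<^sub>R uq - kp *\<^sub>R up) = E *v (kr *\<^sub>R ur - ks *\<^sub>R us)"
    using k by (simp add: algebra_simps)
  then have "kq *\<^sub>R uq - kp *\<^sub>R up = kr *\<^sub>R ur - ks *\<^sub>R us"
    using inj_matrix_vector_mult[OF theta_basis_invertible[OF E]] by (auto dest: injD)
  then have eqs: "kq = kp" "kr = kp"
    unfolding up_def uq_def ur_def us_def by (auto simp: vec_eq_iff forall_3)
  have all: "E' *v x = kp *\<^sub>R (E *v x)" for x
  proof -
    have x: "x = ((x$2 - x$1 + x$3) / 2) *\<^sub>R up + ((x$1 + x$2 - x$3) / 2) *\<^sub>R uq + x$3 *\<^sub>R ur"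
      unfolding up_def uq_def ur_def by (simp add: vec_eq_iff forall_3 field_simps)
    show ?thesis
      by (subst (1 2) x) (simp add: algebra_simps k eqs)
  qed
  then have "E' = kp *\<^sub>R E"
    by (simp add: matrix_eq scaleR_matrix_vector_assoc)
  moreover have "kp \<noteq> 0"
    using all[of up] inj_matrix_vector_mult[OF theta_basis_invertible[OF E']]
    unfolding up_def by (auto simp: inj_eq vec_eq_iff forall_3 dest: injD[where y = 0])
  ultimately show thesis
    using that by blast
qed

lemma map_box_map_box: "map_box ((*v) A) (map_box ((*v) B) \<Theta>) = map_box ((*v) (A ** B)) \<Theta>"
  by (cases \<Theta> rule: box_cases) (simp add: map_box_def image_image matrix_vector_mul_assoc)

lemma map_box_mat_1: "map_box ((*v) (mat 1)) \<Theta> = \<Theta>"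
  by (cases \<Theta> rule: box_cases) (simp add: map_box_def)

lemma box_j_map_box: "box_j (map_box f \<Theta>) = map_box f (box_j \<Theta>)"
  by (cases \<Theta> rule: box_cases) (simp add: map_box_def box_j_def)

lemma box_i_map_box: "box_i (map_box f \<Theta>) = map_box f (box_i \<Theta>)"
  by (cases \<Theta> rule: box_cases) (simp add: map_box_def box_i_def)

lemma sigma_eq_map_box:
  assumes "theta_basis \<Theta> E"
  shows "sigma \<epsilon> \<delta> \<Theta> = map_box ((*v) (matrix_conj E (Sig_mat \<epsilon> \<delta>))) \<Theta>"
proof -
  define E' where "E' = (SOME E. theta_basis \<Theta> E)"
  have "theta_basis \<Theta> E'"
    unfolding E'_def using assms by (rule someI)
  then obtain k where "k \<noteq> 0" "E' = k *\<^sub>R E"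
    by (rule theta_basis_unique[OF assms])
  then have "matrix_conj E' (Sig_mat \<epsilon> \<delta>) = matrix_conj E (Sig_mat \<epsilon> \<delta>)"
    using theta_basis_invertible[OF assms] by (simp add: matrix_conj_scaleR)
  moreover have "(\<lambda>v. E' *v (Sig_mat \<epsilon> \<delta> *v (matrix_inv E' *v v))) = (*v) (matrix_conj E' (Sig_mat \<epsilon> \<delta>))"
    by (simp add: matrix_conj_def matrix_vector_mul_assoc matrix_mul_assoc)
  ultimately show ?thesis
    by (simp add: sigma_def E'_def)
qed

lemma theta_basis_map_box:
  assumes "theta_basis \<Theta> E" "invertible F"
  shows "theta_basis (map_box ((*v) F) \<Theta>) (F ** E)"
  using assms
  by (cases \<Theta> rule: box_cases)
    (simp add: theta_basis_def map_box_def span_singleton_image matrix_vector_mul_assoc invertible_mult)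

lemma overmarked_map_box:
  assumes "overmarked \<Theta>" "invertible F"
  shows "overmarked (map_box ((*v) F) \<Theta>)"
proof -
  let ?f = "(*v) F"
  have lin: "linear ?f" and inj: "inj ?f"
    using assms(2) by (simp_all add: matrix_vector_mul_linear inj_matrix_vector_mult)
  have point: "is_ppoint (?f ` x)" if "is_ppoint x" for x
    using that inj linear_0[OF lin] unfolding is_ppoint_def
    by (metis span_singleton_image injD)
  have line: "is_pline (?f ` L)" if "is_pline L" for L
    using that lin inj unfolding is_pline_def
    by (metis dim_image_eq inj_on_subset subset_UNIV linear_subspace_image)
  have join: "join (?f ` x) (?f ` y) = ?f ` join x y" for x y
    unfolding join_def image_Un[symmetric] by (rule span_linear_image[OF lin])
  obtain p q r s t b P Q R S T B where \<Theta>: "\<Theta> = ((p, q, r, s, t, b), (P, Q, R, S, T, B))"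
    by (rule box_cases)
  show ?thesis
    using assms(1) unfolding \<Theta> map_box_def overmarked_def prod.case
    by (clarsimp simp: point line join inj_image_eq_iff[OF inj] image_Int[OF inj, symmetric])
qed

section \<open>The matrices of \<sigma>, j and i\<close>

lemma Sig_mat_mult_neg: "Sig_mat \<epsilon> \<delta> ** Sig_mat (-\<epsilon>) (-\<delta>) = mat 1"
proof -
  have "cosh \<epsilon> * cosh \<epsilon> - sinh \<epsilon> * sinh \<epsilon> = 1"
    using cosh_square_eq[of \<epsilon>] by (simp add: power2_eq_square)
  moreover have "exp (-\<delta>) * exp \<delta> = 1"
    by (simp add: exp_minus)
  ultimately show ?thesis
    unfolding Sig_mat_def
    by (simp add: matrix_matrix_mult_def mat_def vec_eq_iff forall_3 sum_3 algebra_simps)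
qed

lemma matrix_inv_Sig_mat: "matrix_inv (Sig_mat \<epsilon> \<delta>) = Sig_mat (-\<epsilon>) (-\<delta>)"
  by (rule matrix_inv_unique) (rule Sig_mat_mult_neg)

lemma invertible_Sig_mat: "invertible (Sig_mat \<epsilon> \<delta>)"
  using Sig_mat_mult_neg invertible_right_inverse by blast

text \<open>\<open>i_matrix\<close> sends the frame vectors of r, s to minus those of p, q; projectively the sign
  is invisible.\<close>

definition j_matrix :: "real^3^3" where
  "j_matrix = vector [vector [-1, 0, 0], vector [0, 1, 0], vector [0, 0, 1]]"

definition i_matrix :: "real^3^3" where
  "i_matrix = vector [vector [1, 0, 0], vector [0, 0, -1], vector [0, 1, 0]]"

lemma matrix_inv_j_matrix: "matrix_inv j_matrix = j_matrix"
  by (rule matrix_inv_unique)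
    (simp add: j_matrix_def matrix_matrix_mult_def mat_def vec_eq_iff forall_3 sum_3)

lemma matrix_inv_i_matrix: "matrix_inv i_matrix = transpose i_matrix"
  by (rule matrix_inv_unique)
    (simp add: i_matrix_def transpose_def matrix_matrix_mult_def mat_def vec_eq_iff forall_3 sum_3)

lemma invertible_j_matrix: "invertible j_matrix"
  and invertible_i_matrix: "invertible i_matrix"
  by (auto simp: invertible_det_nz j_matrix_def i_matrix_def det_3)

lemma matrix_conj_j_matrix_Sig_mat: "matrix_conj j_matrix (Sig_mat \<epsilon> \<delta>) = Sig_mat \<epsilon> \<delta>"
  unfolding matrix_conj_def matrix_inv_j_matrix
  by (simp add: j_matrix_def Sig_mat_def matrix_matrix_mult_def vec_eq_iff forall_3 sum_3)

lemma matrix_conj_i_matrix_Sig_mat: "matrix_conj i_matrix (Sig_mat (-\<epsilon>) (-\<delta>)) = Sig_mat \<epsilon> \<delta>"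
  unfolding matrix_conj_def matrix_inv_i_matrix
  by (simp add: i_matrix_def Sig_mat_def transpose_def matrix_matrix_mult_def vec_eq_iff forall_3 sum_3)

lemma theta_basis_box_j:
  assumes "theta_basis \<Theta> E"
  shows "theta_basis (box_j \<Theta>) (E ** j_matrix)"
proof -
  have "j_matrix *v vector [-1, 1, 0] = vector [1, 1, 0]" "j_matrix *v vector [1, 1, 0] = vector [-1, 1, 0]"
    "j_matrix *v vector [1, 0, 1] = vector [-1, 0, 1]" "j_matrix *v vector [-1, 0, 1] = vector [1, 0, 1]"
    unfolding j_matrix_def by (simp_all add: matrix_vector_mult_def vec_eq_iff forall_3 sum_3)
  then show ?thesis
    using assms by (cases \<Theta> rule: box_cases)
      (simp add: theta_basis_def box_j_def invertible_mult invertible_j_matrix flip: matrix_vector_mul_assoc)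
qed

lemma theta_basis_box_i:
  assumes "theta_basis \<Theta> E"
  shows "theta_basis (box_i \<Theta>) (E ** i_matrix)"
proof -
  have "i_matrix *v vector [-1, 1, 0] = vector [-1, 0, 1]" "i_matrix *v vector [1, 1, 0] = vector [1, 0, 1]"
    "i_matrix *v vector [1, 0, 1] = - vector [-1, 1, 0]"
    "i_matrix *v vector [-1, 0, 1] = - vector [1, 1, 0]"
    unfolding i_matrix_def by (simp_all add: matrix_vector_mult_def vec_eq_iff forall_3 sum_3)
  moreover have "span {E *v - x} = span {E *v x}" for x
  proof -
    have "span {E *v - x} = span {(-1) *\<^sub>R (E *v x)}"
      using matrix_vector_mult_scaleR[of E "-1" x] by simp
    also have "\<dots> = span {E *v x}"
      by (rule span_scale_nonzero) simp
    finally show ?thesis .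
  qed
  ultimately show ?thesis
    using assms by (cases \<Theta> rule: box_cases)
      (simp add: theta_basis_def box_i_def invertible_mult invertible_i_matrix flip: matrix_vector_mul_assoc)
qed

lemma theta_basis_sigma:
  assumes "theta_basis \<Theta> E"
  shows "theta_basis (sigma \<epsilon> \<delta> \<Theta>) (E ** Sig_mat \<epsilon> \<delta>)"
proof -
  have E: "invertible E"
    using assms by (rule theta_basis_invertible)
  have "theta_basis (sigma \<epsilon> \<delta> \<Theta>) (matrix_conj E (Sig_mat \<epsilon> \<delta>) ** E)"
    unfolding sigma_eq_map_box[OF assms]
    by (intro theta_basis_map_box assms invertible_matrix_conj E invertible_Sig_mat)
  then show ?thesis
    by (simp add: matrix_conj_mult_self E)
qed

section \<open>Action on boxes and marked boxes\<close>

lemma sigma_neg_sigma: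
  assumes "theta_basis \<Theta> E"
  shows "sigma (-\<epsilon>) (-\<delta>) (sigma \<epsilon> \<delta> \<Theta>) = \<Theta>"
proof -
  have E: "invertible E"
    using assms by (rule theta_basis_invertible)
  have "matrix_conj (Sig_mat \<epsilon> \<delta>) (Sig_mat (-\<epsilon>) (-\<delta>)) = Sig_mat (-\<epsilon>) (-\<delta>)"
    by (simp add: matrix_conj_def matrix_inv_Sig_mat Sig_mat_mult_neg)
  then have "matrix_conj (E ** Sig_mat \<epsilon> \<delta>) (Sig_mat (-\<epsilon>) (-\<delta>)) = matrix_conj E (Sig_mat (-\<epsilon>) (-\<delta>))"
    by (simp add: matrix_conj_conj E invertible_Sig_mat)
  then have "sigma (-\<epsilon>) (-\<delta>) (sigma \<epsilon> \<delta> \<Theta>)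
      = map_box ((*v) (matrix_conj E (Sig_mat (-\<epsilon>) (-\<delta>)) ** matrix_conj E (Sig_mat \<epsilon> \<delta>))) \<Theta>"
    unfolding sigma_eq_map_box[OF theta_basis_sigma[OF assms]]
    by (simp add: sigma_eq_map_box[OF assms] map_box_map_box)
  also have "\<dots> = \<Theta>"
    using Sig_mat_mult_neg[of "-\<epsilon>" "-\<delta>"]
    by (simp add: E matrix_conj_mult matrix_conj_one map_box_mat_1)
  finally show ?thesis .
qed

lemma sigma_box_j:
  assumes "theta_basis \<Theta> E"
  shows "sigma \<epsilon> \<delta> (box_j \<Theta>) = box_j (sigma \<epsilon> \<delta> \<Theta>)"
  using theta_basis_invertible[OF assms] invertible_j_matrix
  by (simp add: sigma_eq_map_box[OF theta_basis_box_j[OF assms]] sigma_eq_map_box[OF assms]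
      matrix_conj_conj matrix_conj_j_matrix_Sig_mat box_j_map_box)

lemma box_i_sigma:
  assumes "theta_basis \<Theta> E"
  shows "box_i (sigma \<epsilon> \<delta> \<Theta>) = sigma (-\<epsilon>) (-\<delta>) (box_i \<Theta>)"
  using theta_basis_invertible[OF assms] invertible_i_matrix
  by (simp add: sigma_eq_map_box[OF theta_basis_box_i[OF assms]] sigma_eq_map_box[OF assms]
      matrix_conj_conj matrix_conj_i_matrix_Sig_mat box_i_map_box)

lemma overmarked_sigma:
  assumes "overmarked \<Theta>"
  shows "overmarked (sigma \<epsilon> \<delta> \<Theta>)"
proof -
  obtain E where E: "theta_basis \<Theta> E"
    using assms by (rule overmarked_has_theta_basis)
  show ?thesis
    unfolding sigma_eq_map_box[OF E]
    by (intro overmarked_map_box assms invertible_matrix_conj theta_basis_invertible[OF E] invertible_Sig_mat)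
qed

lemma marked_boxesE:
  assumes "M \<in> marked_boxes"
  obtains \<Theta> E where "M = {\<Theta>, box_j \<Theta>}" "overmarked \<Theta>" "theta_basis \<Theta> E"
  using assms overmarked_has_theta_basis unfolding marked_boxes_def by blast

lemma on_marked_in_marked_boxes:
  assumes "M \<in> marked_boxes"
  shows "on_marked (sigma \<epsilon> \<delta>) M \<in> marked_boxes"
proof -
  obtain \<Theta> E where "M = {\<Theta>, box_j \<Theta>}" "overmarked \<Theta>" "theta_basis \<Theta> E"
    using assms by (rule marked_boxesE)
  then have "on_marked (sigma \<epsilon> \<delta>) M = {sigma \<epsilon> \<delta> \<Theta>, box_j (sigma \<epsilon> \<delta> \<Theta>)}"
    "overmarked (sigma \<epsilon> \<delta> \<Theta>)"
    by (simp_all add: on_marked_def sigma_box_j overmarked_sigma)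
  then show ?thesis
    unfolding marked_boxes_def by blast
qed

lemma on_marked_eqI:
  assumes "M \<in> marked_boxes" and "\<And>\<Theta> E. theta_basis \<Theta> E \<Longrightarrow> f \<Theta> = g \<Theta>"
  shows "on_marked f M = on_marked g M"
proof -
  obtain \<Theta> E where M: "M = {\<Theta>, box_j \<Theta>}" and E: "theta_basis \<Theta> E"
    using assms(1) by (rule marked_boxesE)
  have "f \<Theta> = g \<Theta>" "f (box_j \<Theta>) = g (box_j \<Theta>)"
    using assms(2) E theta_basis_box_j[OF E] by blast+
  then show ?thesis
    unfolding on_marked_def M by simp
qed

theorem lemma7p3:
  fixes \<epsilon> \<delta> :: real
  shows "(\<forall>M\<in>marked_boxes.
            on_marked (sigma \<epsilon> \<delta>) M \<in> marked_boxes \<and>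
            on_marked (sigma (-\<epsilon>) (-\<delta>)) M \<in> marked_boxes \<and>
            on_marked (sigma (-\<epsilon>) (-\<delta>)) (on_marked (sigma \<epsilon> \<delta>) M) = M \<and>
            on_marked (sigma \<epsilon> \<delta>) (on_marked (sigma (-\<epsilon>) (-\<delta>)) M) = M) \<and>
         (\<forall>M\<in>marked_boxes.
            on_marked box_i (on_marked (sigma \<epsilon> \<delta>) M) =
            on_marked (sigma (-\<epsilon>) (-\<delta>)) (on_marked box_i M))"
proof -
  have cancel: "on_marked (sigma (-e) (-d)) (on_marked (sigma e d) M) = M"
    if "M \<in> marked_boxes" for e d :: real and M
    using on_marked_eqI[OF that, of "sigma (-e) (-d) \<circ> sigma e d" id] sigma_neg_sigma
    by (simp add: on_marked_def image_comp)
  have "on_marked box_i (on_marked (sigma \<epsilon> \<delta>) M) = on_marked (sigma (-\<epsilon>) (-\<delta>)) (on_marked box_i M)"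
    if "M \<in> marked_boxes" for M
    using on_marked_eqI[OF that, of "box_i \<circ> sigma \<epsilon> \<delta>" "sigma (-\<epsilon>) (-\<delta>) \<circ> box_i"] box_i_sigma
    by (simp add: on_marked_def image_comp)
  then show ?thesis
    using cancel[of _ "-\<epsilon>" "-\<delta>"] by (simp add: on_marked_in_marked_boxes cancel)
qed

end
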